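(* Let $\Phi$ be a family of probability distributions such that, for every $d\in\mathbb{N}$, the members of $\Phi$ that are distributions on $\mathbb{R}^d$ form a dense subset of the space of all probability distributions on $\mathbb{R}^d$ with respect to weak convergence. Let $T>0$. Then the class of processes built as linear interpolations of $\Phi$ random vectors is dense, with respect to weak convergence, in the space of stochastic processes with paths in $C([0,T])$ endowed with the uniform topology. That is, for every stochastic process $X=(X_t)_{t\in[0,T]}$ with paths in $C([0,T])$ there is a sequence $(\hat Y^{(n)})_{n\in\mathbb{N}}$ of linear interpolations on $[0,T]$ of $\Phi$ random vectors such that $\hat Y^{(n)}\stackrel{d}{\to}X$ as $n\to\infty$ in $C([0,T])$ with the uniform topology.
   Context: $C([0,T])$ is the space of real continuous functions on $[0,T]$ with the supremum norm. A $\Phi$ random vector is a random vector whose distribution belongs to $\Phi$. Given $N\in\mathbb{N}$ and a random vector $Y=(Y_0,Y_1,\dots,Y_N)$ in $\mathbb{R}^{N+1}$, its linear interpolation on $[0,T]$ is the process $(\hat Y_t)_{t\in[0,T]}$ with continuous paths such that $\hat Y_{kT/N}=Y_k$ for $k=0,\dots,N$ and $\hat Y$ is affine on each interval $[kT/N,(k+1)T/N]$, $k=0,\dots,N-1$. Processes with paths in $C([0,T])$ are viewed as random elements of $C([0,T])$ with its Borel $\sigma$-algebra, and weak convergence (convergence in distribution, $\stackrel{d}{\to}$) means weak convergence of their laws on $C([0,T])$. The processes need not be defined on the same probability space. *)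

theory Defs
  imports "HOL-Probability.Probability"
begin

section \<open>Probability distributions on a topological space\<close>

definition borel_of :: "'a topology \<Rightarrow> 'a measure" where
  "borel_of X = sigma (topspace X) {U. openin X U}"

definition distributions :: "'a topology \<Rightarrow> 'a measure set" where
  "distributions X = {\<mu>. prob_space \<mu> \<and> sets \<mu> = sets (borel_of X)}"

definition bounded_continuous :: "'a topology \<Rightarrow> ('a \<Rightarrow> real) set" where
  "bounded_continuous X = {f. continuous_map X euclideanreal f \<and> bounded (f ` topspace X)}"

definition converges_weakly ::
    "'a topology \<Rightarrow> (nat \<Rightarrow> 'a measure) \<Rightarrow> 'a measure \<Rightarrow> bool" where
  "converges_weakly X \<mu> \<nu> \<longleftrightarrow>
     (\<forall>n. \<mu> n \<in> distributions X) \<and> \<nu> \<in> distributions X \<and>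
     (\<forall>f\<in>bounded_continuous X. (\<lambda>n. integral\<^sup>L (\<mu> n) f) \<longlonglongrightarrow> integral\<^sup>L \<nu> f)"

text \<open>
  The topology of weak convergence: the coarsest topology on the set of distributions for which
  integration against each bounded continuous function is continuous.
\<close>

definition weak_topology :: "'a topology \<Rightarrow> 'a measure topology" where
  "weak_topology X = topology_generated_by
     {{\<mu> \<in> distributions X. integral\<^sup>L \<mu> f \<in> U} | f U. f \<in> bounded_continuous X \<and> open U}"

definition weakly_dense :: "'a topology \<Rightarrow> 'a measure set \<Rightarrow> bool" where
  "weakly_dense X A \<longleftrightarrow>
     A \<subseteq> distributions X \<and> weak_topology X closure_of A = distributions X"

lemma topspace_weak_topology [simp]: "topspace (weak_topology X) = distributions X"
proof -
  have "(\<lambda>_. 0) \<in> bounded_continuous X"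
    by (auto simp: bounded_continuous_def bounded_iff)
  moreover have "distributions X = {\<mu> \<in> distributions X. integral\<^sup>L \<mu> (\<lambda>_. 0) \<in> (UNIV :: real set)}"
    by simp
  ultimately have "\<exists>f U. distributions X = {\<mu> \<in> distributions X. integral\<^sup>L \<mu> f \<in> U} \<and>
      f \<in> bounded_continuous X \<and> open U"
    using open_UNIV by blast
  then show ?thesis
    unfolding weak_topology_def topology_generated_by_topspace by blast
qed

lemma converges_weakly_iff_limitin:
  assumes "\<And>n. \<mu> n \<in> distributions X"
  shows "converges_weakly X \<mu> \<nu> \<longleftrightarrow> limitin (weak_topology X) \<mu> \<nu> sequentially"
proof
  let ?B = "{{\<mu> \<in> distributions X. integral\<^sup>L \<mu> f \<in> U} | f U. f \<in> bounded_continuous X \<and> open U}"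
  assume conv: "converges_weakly X \<mu> \<nu>"
  have "\<nu> \<in> S \<longrightarrow> (\<forall>\<^sub>F n in sequentially. \<mu> n \<in> S)" if "generate_topology_on ?B S" for S
    using that
  proof induction
    case Empty
    show ?case by simp
  next
    case (Int a b)
    then show ?case by (auto intro: eventually_conj)
  next
    case (UN K)
    show ?case
    proof
      assume "\<nu> \<in> \<Union>K"
      then obtain k where k: "k \<in> K" "\<nu> \<in> k" by blast
      with UN have "\<forall>\<^sub>F n in sequentially. \<mu> n \<in> k" by blast
      then show "\<forall>\<^sub>F n in sequentially. \<mu> n \<in> \<Union>K"
        by (rule eventually_mono) (use k in blast)
    qed
  next
    case (Basis s)
    then obtain f U where s: "s = {\<mu> \<in> distributions X. integral\<^sup>L \<mu> f \<in> U}"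
      and f: "f \<in> bounded_continuous X" and U: "open U" by blast
    show ?case
    proof
      assume "\<nu> \<in> s"
      then have "integral\<^sup>L \<nu> f \<in> U" by (simp add: s)
      moreover have "(\<lambda>n. integral\<^sup>L (\<mu> n) f) \<longlonglongrightarrow> integral\<^sup>L \<nu> f"
        using conv f by (simp add: converges_weakly_def)
      ultimately have "\<forall>\<^sub>F n in sequentially. integral\<^sup>L (\<mu> n) f \<in> U"
        using U topological_tendstoD by blast
      then show "\<forall>\<^sub>F n in sequentially. \<mu> n \<in> s"
        by (rule eventually_mono) (simp add: s assms)
    qed
  qed
  then show "limitin (weak_topology X) \<mu> \<nu> sequentially"
    using conv unfolding limitin_def
    by (auto simp: converges_weakly_def weak_topology_def[THEN arg_cong[where f=openin]]
        openin_topology_generated_by_iff)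
next
  assume lim: "limitin (weak_topology X) \<mu> \<nu> sequentially"
  then have \<nu>: "\<nu> \<in> distributions X" by (simp add: limitin_def)
  have "(\<lambda>n. integral\<^sup>L (\<mu> n) f) \<longlonglongrightarrow> integral\<^sup>L \<nu> f" if f: "f \<in> bounded_continuous X" for f
  proof (rule topological_tendstoI)
    fix U :: "real set"
    assume U: "open U" "integral\<^sup>L \<nu> f \<in> U"
    let ?S = "{\<mu> \<in> distributions X. integral\<^sup>L \<mu> f \<in> U}"
    have "openin (weak_topology X) ?S"
      unfolding weak_topology_def by (rule topology_generated_by_Basis) (use f U in blast)
    then have "\<forall>\<^sub>F n in sequentially. \<mu> n \<in> ?S"
      using lim \<nu> U unfolding limitin_def by blast
    then show "\<forall>\<^sub>F n in sequentially. integral\<^sup>L (\<mu> n) f \<in> U"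
      by (rule eventually_mono) simp
  qed
  then show "converges_weakly X \<mu> \<nu>"
    using assms \<nu> by (simp add: converges_weakly_def)
qed


section \<open>Processes with continuous paths\<close>

text \<open>
  The points of \<open>C([0,T])\<close> are the continuous functions on \<open>{0..T}\<close>, extended by \<open>undefined\<close> outside;
  boundedness, which \<^const>\<open>cfunspace\<close> also asks for, is automatic.
\<close>

definition C_space :: "real \<Rightarrow> (real \<Rightarrow> real) topology" where
  "C_space T = mtopology_of (cfunspace (top_of_set {0..T}) euclidean_metric)"

lemma topspace_C_space:
  "topspace (C_space T) = {f \<in> extensional {0..T}. continuous_on {0..T} f}"
  unfolding C_space_def topspace_mtopology_of mspace_cfunspace
  by (auto simp: compact_continuous_image compact_imp_bounded)

definition continuous_process :: "real \<Rightarrow> 'a measure \<Rightarrow> (real \<Rightarrow> 'a \<Rightarrow> real) \<Rightarrow> bool" where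
  "continuous_process T M X \<longleftrightarrow>
     prob_space M \<and> (\<forall>t\<in>{0..T}. X t \<in> borel_measurable M) \<and>
     (\<forall>\<omega>\<in>space M. continuous_on {0..T} (\<lambda>t. X t \<omega>))"

definition path_law :: "real \<Rightarrow> 'a measure \<Rightarrow> (real \<Rightarrow> 'a \<Rightarrow> real) \<Rightarrow> (real \<Rightarrow> real) measure" where
  "path_law T M X = distr M (borel_of (C_space T)) (\<lambda>\<omega>. \<lambda>t\<in>{0..T}. X t \<omega>)"


section \<open>Linear interpolations of random vectors\<close>

definition linear_interpolation :: "real \<Rightarrow> nat \<Rightarrow> (nat \<Rightarrow> real) \<Rightarrow> (real \<Rightarrow> real) \<Rightarrow> bool" where
  "linear_interpolation T N y g \<longleftrightarrow>
     continuous_on {0..T} g \<and>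
     (\<forall>k\<le>N. g (real k * T / real N) = y k) \<and>
     (\<forall>k<N. \<exists>a b. \<forall>t\<in>{real k * T / real N..real (Suc k) * T / real N}. g t = a + b * t)"

text \<open>
  A point of \<open>\<real>\<^sup>d\<close> is a function \<open>nat \<Rightarrow> real\<close> supported on \<open>{..<d}\<close>, see
  \<^const>\<open>Euclidean_space\<close>. So distributions on all the spaces \<open>\<real>\<^sup>d\<close> have the same type, and the
  family \<open>\<Phi>\<close> below is a single set. A vector in \<open>\<real>\<^sup>N\<^sup>+\<^sup>1\<close> has the components \<open>0, \<dots>, N\<close>.
\<close>

definition random_vector_in ::
    "(nat \<Rightarrow> real) measure set \<Rightarrow> nat \<Rightarrow> 'a measure \<Rightarrow> ('a \<Rightarrow> nat \<Rightarrow> real) \<Rightarrow> bool" where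
  "random_vector_in \<Phi> d M Y \<longleftrightarrow>
     prob_space M \<and> Y \<in> M \<rightarrow>\<^sub>M borel_of (Euclidean_space d) \<and>
     distr M (borel_of (Euclidean_space d)) Y \<in> \<Phi>"

definition interpolates_random_vector ::
    "real \<Rightarrow> (nat \<Rightarrow> real) measure set \<Rightarrow> 'a measure \<Rightarrow> (real \<Rightarrow> 'a \<Rightarrow> real) \<Rightarrow> bool" where
  "interpolates_random_vector T \<Phi> M Z \<longleftrightarrow>
     (\<exists>N\<ge>1. \<exists>Y. random_vector_in \<Phi> (N + 1) M Y \<and>
        (\<forall>\<omega>\<in>space M. linear_interpolation T N (Y \<omega>) (\<lambda>t. Z t \<omega>)))"

text \<open>
  The sample space has the fixed type \<open>nat \<Rightarrow> real\<close>. This loses no laws: the law of an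
  interpolation is determined by that of the random vector, which is also the law of the identity
  on \<open>\<real>\<^sup>N\<^sup>+\<^sup>1\<close> under the distribution of the vector.
\<close>

definition interpolation_laws ::
    "real \<Rightarrow> (nat \<Rightarrow> real) measure set \<Rightarrow> (real \<Rightarrow> real) measure set" where
  "interpolation_laws T \<Phi> =
     {path_law T M Z | (M :: (nat \<Rightarrow> real) measure) Z. interpolates_random_vector T \<Phi> M Z}"

end

theory Submission
  imports Defs
begin

text \<open>
  Let \<open>\<nu>\<close> be a law on \<open>C([0,T])\<close>. Sampling a path on the grid \<open>k T / N\<close> is a continuous map into
  \<open>\<real>\<^sup>N\<^sup>+\<^sup>1\<close>, interpolating linearly is a continuous map back, and by uniform continuity of paths
  the composition tends pointwise to the identity as \<open>N\<close> grows. So \<open>\<nu>\<close> is the weak limit of the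
  laws of its interpolated samples (\<open>integral_interp_sample_tendsto\<close>), and for each \<open>N\<close> the law of
  the sample vector can be approximated by members of \<open>\<Phi>\<close>.

  These two limits have to be merged into one sequence. A bounded continuous test function on
  \<open>C([0,T])\<close>, composed with interpolation, is a bounded continuous function on \<open>\<real>\<^sup>N\<^sup>+\<^sup>1\<close>, and
  density of \<open>\<Phi>\<close> handles any finite number of these at once (\<open>weak_closure_approx\<close>). It is
  therefore enough that countably many test functions detect weak convergence on \<open>C([0,T])\<close>: then
  successive approximations take care of more and more of them (\<open>interpolation_approx\<close>).

  Such a countable family exists on every separable metric space
  (\<open>convergence_determining_sequence\<close>). It consists of the finite maxima of the tents
  \<open>max 0 (q - k d(a, x))\<close> with \<open>a\<close> in a countable dense set, \<open>q\<close> rational and \<open>k\<close> natural. Every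
  nonnegative continuous function is the supremum of the tents below it, so its integral is lower
  semicontinuous along any sequence for which the integrals of the family converge; applied to
  \<open>B + f\<close> and \<open>B - f\<close> this gives convergence for every bounded continuous \<open>f\<close>.

  Separability of \<open>C([0,T])\<close>, proved through piecewise linear paths with rational nodes, serves a
  second time: it shows that the Borel sets are generated by closed balls and hence that a
  continuous process has a law on \<open>C([0,T])\<close> at all (\<open>path_law_in_distributions\<close>).
\<close>

section \<open>Borel sets, distributions and bounded continuous functions\<close>

lemma space_borel_of [simp]: "space (borel_of X) = topspace X"
  unfolding borel_of_def by (rule space_measure_of) (use openin_subset in blast)

lemma sets_borel_of: "sets (borel_of X) = sigma_sets (topspace X) {U. openin X U}"
  unfolding borel_of_def by (rule sets_measure_of) (use openin_subset in blast)

lemma borel_of_euclidean: "borel_of euclidean = borel"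
  by (simp add: borel_of_def borel_def)

lemma measurable_borel_ofI:
  assumes "f \<in> space M \<rightarrow> topspace X"
    and "\<And>U. openin X U \<Longrightarrow> f -` U \<inter> space M \<in> sets M"
  shows "f \<in> M \<rightarrow>\<^sub>M borel_of X"
  unfolding borel_of_def
  by (rule measurable_measure_of) (use assms openin_subset in blast)+

lemma continuous_map_imp_measurable:
  assumes "continuous_map X Y f"
  shows "f \<in> borel_of X \<rightarrow>\<^sub>M borel_of Y"
proof (rule measurable_borel_ofI)
  show "f \<in> space (borel_of X) \<rightarrow> topspace Y"
    using assms by (auto simp: continuous_map_def)
next
  fix U assume "openin Y U"
  then have "openin X {x \<in> topspace X. f x \<in> U}"
    using assms by (simp add: continuous_map_def)
  moreover have "f -` U \<inter> space (borel_of X) = {x \<in> topspace X. f x \<in> U}"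
    by auto
  ultimately show "f -` U \<inter> space (borel_of X) \<in> sets (borel_of X)"
    by (auto simp: sets_borel_of)
qed

lemma distributionsD:
  assumes "\<mu> \<in> distributions X"
  shows "prob_space \<mu>" "sets \<mu> = sets (borel_of X)" "space \<mu> = topspace X"
  using assms sets_eq_imp_space_eq[of \<mu> "borel_of X"] by (auto simp: distributions_def)

lemma distr_in_distributions:
  assumes "prob_space M" "f \<in> M \<rightarrow>\<^sub>M borel_of X"
  shows "distr M (borel_of X) f \<in> distributions X"
  using assms by (simp add: distributions_def prob_space.prob_space_distr)

lemma bounded_continuousE:
  assumes "f \<in> bounded_continuous X"
  obtains B where "\<And>x. x \<in> topspace X \<Longrightarrow> \<bar>f x\<bar> \<le> B"
proof -
  obtain B where "\<forall>x\<in>f ` topspace X. norm x \<le> B"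
    using assms by (auto simp: bounded_continuous_def bounded_iff)
  then show ?thesis by (intro that[of B]) auto
qed

lemma bounded_continuousI:
  assumes "continuous_map X euclideanreal f" "\<And>x. x \<in> topspace X \<Longrightarrow> \<bar>f x\<bar> \<le> B"
  shows "f \<in> bounded_continuous X"
  using assms by (auto simp: bounded_continuous_def bounded_iff)

lemma bounded_continuous_measurable:
  assumes "\<mu> \<in> distributions X" "f \<in> bounded_continuous X"
  shows "f \<in> borel_measurable \<mu>"
proof -
  have "f \<in> borel_of X \<rightarrow>\<^sub>M borel"
    using assms(2) continuous_map_imp_measurable[of X euclideanreal f]
    by (simp add: bounded_continuous_def borel_of_euclidean)
  then show ?thesis
    using measurable_cong_sets[OF distributionsD(2)[OF assms(1)] refl] by blast
qed

lemma bounded_continuous_integrable: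
  assumes "\<mu> \<in> distributions X" "f \<in> bounded_continuous X"
  shows "integrable \<mu> f"
proof -
  interpret prob_space \<mu> using assms(1) by (rule distributionsD)
  obtain B where "\<And>x. x \<in> topspace X \<Longrightarrow> \<bar>f x\<bar> \<le> B"
    using bounded_continuousE[OF assms(2)] by metis
  then show ?thesis
    by (intro integrable_const_bound[of _ B] bounded_continuous_measurable[OF assms])
      (auto simp: distributionsD(3)[OF assms(1)])
qed

lemma bounded_continuous_compose:
  assumes "continuous_map X Y h" "g \<in> bounded_continuous Y"
  shows "(\<lambda>x. g (h x)) \<in> bounded_continuous X"
proof -
  obtain B where "\<And>y. y \<in> topspace Y \<Longrightarrow> \<bar>g y\<bar> \<le> B"
    using bounded_continuousE[OF assms(2)] by metis
  moreover have "h x \<in> topspace Y" if "x \<in> topspace X" for x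
    using assms(1) that by (auto simp: continuous_map_def)
  moreover have "continuous_map X euclideanreal (\<lambda>x. g (h x))"
    using continuous_map_compose[OF assms(1), of euclideanreal g] assms(2)
    by (simp add: bounded_continuous_def o_def)
  ultimately show ?thesis
    by (intro bounded_continuousI[of _ _ B]) auto
qed

lemma bounded_continuous_affine:
  assumes "f \<in> bounded_continuous X"
  shows "(\<lambda>x. a + s * f x) \<in> bounded_continuous X"
proof -
  obtain B where B: "\<And>x. x \<in> topspace X \<Longrightarrow> \<bar>f x\<bar> \<le> B"
    using bounded_continuousE[OF assms] by metis
  have "\<bar>a + s * f x\<bar> \<le> \<bar>a\<bar> + \<bar>s\<bar> * B" if "x \<in> topspace X" for x
  proof -
    have "\<bar>a + s * f x\<bar> \<le> \<bar>a\<bar> + \<bar>s\<bar> * \<bar>f x\<bar>"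
      by (metis abs_triangle_ineq abs_mult)
    also have "\<dots> \<le> \<bar>a\<bar> + \<bar>s\<bar> * B"
      by (intro add_left_mono mult_left_mono B that) auto
    finally show ?thesis .
  qed
  moreover have "continuous_map X euclideanreal (\<lambda>x. a + s * f x)"
    using assms by (auto simp: bounded_continuous_def intro!: continuous_intros)
  ultimately show ?thesis by (rule bounded_continuousI[rotated])
qed

text \<open>
  A basic neighbourhood in the weak topology is cut out by finitely many test functions. Hence an
  element of the closure can be matched on finitely many of them by one member of \<open>A\<close>, but on
  infinitely many perhaps not even by a sequence.
\<close>
lemma weak_closure_approx:
  assumes "\<nu> \<in> weak_topology X closure_of A"
    and "finite F" "F \<subseteq> bounded_continuous X" "e > 0"
  obtains \<mu> where "\<mu> \<in> A" "\<And>f. f \<in> F \<Longrightarrow> \<bar>integral\<^sup>L \<mu> f - integral\<^sup>L \<nu> f\<bar> < e"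
proof -
  have \<nu>: "\<nu> \<in> distributions X"
    using assms(1) by (simp add: in_closure_of)
  define S where "S f = {\<mu> \<in> distributions X. integral\<^sup>L \<mu> f \<in> ball (integral\<^sup>L \<nu> f) e}" for f :: "'a \<Rightarrow> real"
  have "openin (weak_topology X) (S f)" if "f \<in> F" for f
    unfolding weak_topology_def S_def
    by (rule topology_generated_by_Basis) (use that assms(3) in blast)
  \<comment> \<open>The factor \<open>topspace\<close> keeps the intersection open when \<open>F\<close> is empty.\<close>
  then have "openin (weak_topology X) (topspace (weak_topology X) \<inter> \<Inter>(S ` F))"
    using \<open>finite F\<close> openin_topspace[of "weak_topology X"]
    by (cases "F = {}") (auto intro!: openin_Int openin_Inter simp del: topspace_weak_topology)
  moreover have "\<nu> \<in> topspace (weak_topology X) \<inter> \<Inter>(S ` F)"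
    using \<nu> \<open>e > 0\<close> by (auto simp: S_def)
  ultimately obtain \<mu> where "\<mu> \<in> A" "\<mu> \<in> \<Inter>(S ` F)"
    using assms(1) unfolding in_closure_of by blast
  then show ?thesis
    by (intro that[of \<mu>]) (auto simp: S_def dist_real_def abs_minus_commute)
qed

section \<open>A countable convergence-determining family\<close>

definition finite_max :: "(nat \<Rightarrow> 'a \<Rightarrow> real) \<Rightarrow> nat set \<Rightarrow> 'a \<Rightarrow> real" where
  "finite_max \<phi> S x = Max (insert 0 ((\<lambda>j. \<phi> j x) ` S))"

lemma finite_max_bounded_continuous:
  assumes "finite S" "\<And>j. \<phi> j \<in> bounded_continuous X"
  shows "finite_max \<phi> S \<in> bounded_continuous X"
  using assms(1)
proof induction
  case empty
  show ?case by (rule bounded_continuousI[of _ _ 0]) (simp_all add: finite_max_def)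
next
  case (insert j S)
  have eq: "finite_max \<phi> (insert j S) = (\<lambda>x. max (\<phi> j x) (finite_max \<phi> S x))"
    using insert.hyps by (auto simp: finite_max_def fun_eq_iff insert_commute[of 0])
  obtain B C where B: "\<And>x. x \<in> topspace X \<Longrightarrow> \<bar>\<phi> j x\<bar> \<le> B"
    and C: "\<And>x. x \<in> topspace X \<Longrightarrow> \<bar>finite_max \<phi> S x\<bar> \<le> C"
    using bounded_continuousE[OF assms(2)] bounded_continuousE[OF insert.IH] by metis
  have "\<bar>max (\<phi> j x) (finite_max \<phi> S x)\<bar> \<le> max B C" if "x \<in> topspace X" for x
    using B[OF that] C[OF that] by (auto simp: max_def)
  moreover have "continuous_map X euclideanreal (\<lambda>x. max (\<phi> j x) (finite_max \<phi> S x))"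
    using assms(2)[of j] insert.IH
    by (auto simp: bounded_continuous_def intro!: continuous_intros)
  ultimately show ?case
    unfolding eq by (intro bounded_continuousI) auto
qed

text \<open>
  A nonnegative \<open>f\<close> that is the supremum of those \<open>\<phi> j\<close> lying below it is the increasing limit of
  finite maxima \<open>g m \<le> f\<close>. Choose \<open>m\<close> with the integral of \<open>g m\<close> close to that of \<open>f\<close> under the
  limit \<open>\<nu>\<close>; then convergence of the integrals of this single \<open>g m\<close> bounds the integrals of \<open>f\<close>
  under \<open>\<mu> n\<close> from below.
\<close>
lemma integral_lower_semicontinuous:
  assumes \<mu>: "\<And>n. \<mu> n \<in> distributions X" and \<nu>: "\<nu> \<in> distributions X"
    and \<phi>: "\<And>j. \<phi> j \<in> bounded_continuous X"
    and conv: "\<And>S. finite S \<Longrightarrow>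
      (\<lambda>n. integral\<^sup>L (\<mu> n) (finite_max \<phi> S)) \<longlonglongrightarrow> integral\<^sup>L \<nu> (finite_max \<phi> S)"
    and f: "f \<in> bounded_continuous X" "\<And>x. x \<in> topspace X \<Longrightarrow> 0 \<le> f x"
    and sup: "\<And>x c. x \<in> topspace X \<Longrightarrow> c < f x \<Longrightarrow>
      \<exists>j. (\<forall>y\<in>topspace X. \<phi> j y \<le> f y) \<and> c < \<phi> j x"
    and "e > 0"
  shows "\<forall>\<^sub>F n in sequentially. integral\<^sup>L \<nu> f - e < integral\<^sup>L (\<mu> n) f"
proof -
  define A where "A = {j. \<forall>y\<in>topspace X. \<phi> j y \<le> f y}"
  define g where "g m = finite_max \<phi> (A \<inter> {..<m})" for m
  have g_bc: "g m \<in> bounded_continuous X" for m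
    unfolding g_def by (rule finite_max_bounded_continuous) (simp_all add: \<phi>)
  have g_le: "g m x \<le> f x" if "x \<in> topspace X" for m x
    using that f(2) by (auto simp: g_def finite_max_def A_def)
  have g_nonneg: "0 \<le> g m x" for m x
    by (simp add: g_def finite_max_def)
  have g_lim: "(\<lambda>m. g m x) \<longlonglongrightarrow> f x" if x: "x \<in> topspace X" for x
  proof (rule order_tendstoI)
    fix c assume "f x < c"
    then show "\<forall>\<^sub>F m in sequentially. g m x < c"
      by (intro always_eventually allI order.strict_trans1[OF g_le[OF x]])
  next
    fix c assume "c < f x"
    then obtain j where j: "j \<in> A" "c < \<phi> j x"
      using sup[OF x] by (auto simp: A_def)
    have "c < g m x" if "m > j" for m
    proof -
      have "\<phi> j x \<le> g m x"
        unfolding g_def finite_max_def by (rule Max_ge) (use j that in auto)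
      with j show ?thesis by simp
    qed
    then show "\<forall>\<^sub>F m in sequentially. c < g m x"
      using eventually_gt_at_top by (rule eventually_mono[rotated])
  qed
  have "(\<lambda>m. integral\<^sup>L \<nu> (g m)) \<longlonglongrightarrow> integral\<^sup>L \<nu> f"
  proof (rule integral_dominated_convergence[where w = f])
    show "AE x in \<nu>. (\<lambda>m. g m x) \<longlonglongrightarrow> f x" "\<And>m. AE x in \<nu>. norm (g m x) \<le> f x"
      using g_lim g_le g_nonneg by (auto simp: distributionsD(3)[OF \<nu>])
  qed (use \<nu> f(1) g_bc in \<open>auto intro: bounded_continuous_measurable bounded_continuous_integrable\<close>)
  then have "\<forall>\<^sub>F m in sequentially. integral\<^sup>L \<nu> f - e < integral\<^sup>L \<nu> (g m)"
    using \<open>e > 0\<close> by (intro order_tendstoD) auto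
  then obtain m where m: "integral\<^sup>L \<nu> f - e < integral\<^sup>L \<nu> (g m)"
    using eventually_happens by force
  have "(\<lambda>n. integral\<^sup>L (\<mu> n) (g m)) \<longlonglongrightarrow> integral\<^sup>L \<nu> (g m)"
    unfolding g_def by (rule conv) simp
  then have "\<forall>\<^sub>F n in sequentially. integral\<^sup>L \<nu> f - e < integral\<^sup>L (\<mu> n) (g m)"
    using m by (rule order_tendstoD)
  moreover have "integral\<^sup>L (\<mu> n) (g m) \<le> integral\<^sup>L (\<mu> n) f" for n
    by (rule integral_mono)
      (use \<mu> f g_bc g_le in \<open>auto intro: bounded_continuous_integrable simp: distributionsD(3)[OF \<mu>]\<close>)
  ultimately show ?thesis
    by (auto elim!: eventually_mono intro: order.strict_trans2)
qed

text \<open>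
  If \<open>\<bar>f\<bar> \<le> B\<close>, then the lower bound applies to both nonnegative functions \<open>B + f\<close> and \<open>B - f\<close>,
  and the two bounds together give convergence of the integrals of \<open>f\<close>.
\<close>
lemma converges_weakly_if_finite_max:
  assumes \<mu>: "\<And>n. \<mu> n \<in> distributions X" and \<nu>: "\<nu> \<in> distributions X"
    and \<phi>: "\<And>j. \<phi> j \<in> bounded_continuous X"
    and sup: "\<And>f x c. f \<in> bounded_continuous X \<Longrightarrow> (\<And>y. y \<in> topspace X \<Longrightarrow> 0 \<le> f y) \<Longrightarrow>
      x \<in> topspace X \<Longrightarrow> c < f x \<Longrightarrow> \<exists>j. (\<forall>y\<in>topspace X. \<phi> j y \<le> f y) \<and> c < \<phi> j x"
    and conv: "\<And>S. finite S \<Longrightarrow>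
      (\<lambda>n. integral\<^sup>L (\<mu> n) (finite_max \<phi> S)) \<longlonglongrightarrow> integral\<^sup>L \<nu> (finite_max \<phi> S)"
  shows "converges_weakly X \<mu> \<nu>"
  unfolding converges_weakly_def
proof (intro conjI ballI allI \<mu> \<nu>)
  fix f assume f: "f \<in> bounded_continuous X"
  obtain B where B: "\<And>x. x \<in> topspace X \<Longrightarrow> \<bar>f x\<bar> \<le> B"
    using bounded_continuousE[OF f] by metis
  have shift: "integral\<^sup>L \<kappa> (\<lambda>x. B + s * f x) = B + s * integral\<^sup>L \<kappa> f"
    if "\<kappa> \<in> distributions X" for \<kappa> s
  proof -
    interpret prob_space \<kappa> using that by (rule distributionsD)
    show ?thesis
      using bounded_continuous_integrable[OF that f] by (simp add: prob_space)
  qed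
  have lower: "\<forall>\<^sub>F n in sequentially. s * integral\<^sup>L \<nu> f - e < s * integral\<^sup>L (\<mu> n) f"
    if "e > 0" "\<bar>s\<bar> = 1" for e s :: real
  proof -
    have nonneg: "0 \<le> B + s * f x" if "x \<in> topspace X" for x
      using B[OF that] \<open>\<bar>s\<bar> = 1\<close> by (auto simp: abs_if split: if_splits)
    note bc = bounded_continuous_affine[OF f, of B s]
    have "\<forall>\<^sub>F n in sequentially.
      integral\<^sup>L \<nu> (\<lambda>x. B + s * f x) - e < integral\<^sup>L (\<mu> n) (\<lambda>x. B + s * f x)"
      by (rule integral_lower_semicontinuous[where X = X and \<phi> = \<phi>])
        (use \<mu> \<nu> \<phi> conv bc nonneg sup[OF bc] \<open>e > 0\<close> in auto)
    then show ?thesis by (simp add: shift \<mu> \<nu> algebra_simps)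
  qed
  show "(\<lambda>n. integral\<^sup>L (\<mu> n) f) \<longlonglongrightarrow> integral\<^sup>L \<nu> f"
  proof (rule tendstoI)
    fix e :: real assume "e > 0"
    show "\<forall>\<^sub>F n in sequentially. dist (integral\<^sup>L (\<mu> n) f) (integral\<^sup>L \<nu> f) < e"
      using lower[OF \<open>e > 0\<close>, of 1, simplified] lower[OF \<open>e > 0\<close>, of "-1", simplified]
      by eventually_elim (simp add: dist_real_def abs_less_iff)
  qed
qed

context Metric_space
begin

definition tent :: "'a \<Rightarrow> real \<Rightarrow> nat \<Rightarrow> 'a \<Rightarrow> real" where
  "tent a q k x = max 0 (q - real k * d a x)"

lemma tent_bounded_continuous:
  assumes "a \<in> M"
  shows "tent a q k \<in> bounded_continuous mtopology"
proof (rule bounded_continuousI)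
  have "continuous_map mtopology euclideanreal (d a)"
    using continuous_map_mdist[of mtopology Self "\<lambda>_. a" "\<lambda>x. x"] assms
    by (simp add: mtopology_of_def)
  then show "continuous_map mtopology euclideanreal (tent a q k)"
    unfolding tent_def by (auto intro!: continuous_intros)
  have "0 \<le> real k * d a x" for x by simp
  then show "\<bar>tent a q k x\<bar> \<le> \<bar>q\<bar>" for x
    unfolding tent_def by (smt (verit))
qed

text \<open>
  By continuity, \<open>f\<close> exceeds some rational \<open>q > c\<close> on a ball around \<open>x\<close>. A tent of height \<open>q\<close> whose
  apex \<open>a\<close> is close to \<open>x\<close>, and which is so steep that it vanishes outside that ball, fits below
  \<open>f\<close>; the apex can be so close that the tent still exceeds \<open>c\<close> at \<open>x\<close>.
\<close>
lemma tent_minorant: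
  assumes D: "D \<subseteq> M" "\<forall>x\<in>M. \<forall>e>0. \<exists>a\<in>D. d x a < e"
    and f: "continuous_map mtopology euclideanreal f" "\<And>y. y \<in> M \<Longrightarrow> 0 \<le> f y"
    and x: "x \<in> M" "c < f x"
  shows "\<exists>a\<in>D. \<exists>q\<in>\<rat>. \<exists>k. (\<forall>y\<in>M. tent a q k y \<le> f y) \<and> c < tent a q k x"
proof (cases "c < 0")
  case True
  obtain a where a: "a \<in> D" using D(2) x(1) zero_less_one by blast
  \<comment> \<open>A negative \<open>c\<close> would allow \<open>q < 0\<close>, so the zero function is used instead.\<close>
  have "tent a 0 0 y = 0" for y by (simp add: tent_def)
  then show ?thesis using a True f(2) by (intro bexI[of _ a] bexI[of _ 0] exI[of _ 0]) auto
next
  case False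
  obtain q where q: "q \<in> \<rat>" "c < q" "q < f x"
    using Rats_dense_in_real[OF x(2)] by blast
  have "q > 0" using False q by simp
  have "openin mtopology {y \<in> M. f y \<in> {q<..}}"
    using f(1) unfolding continuous_map_def by (auto simp del: greaterThan_iff)
  then obtain \<delta> where \<delta>: "\<delta> > 0" "mball x \<delta> \<subseteq> {y \<in> M. f y \<in> {q<..}}"
    using x q unfolding openin_mtopology by force
  obtain k :: nat where k: "2 * q / \<delta> < real k"
    using reals_Archimedean2 by blast
  then have "k > 0" using \<open>q > 0\<close> \<delta>(1) by (cases k) (auto simp: field_simps)
  obtain a where a: "a \<in> D" "d x a < min (\<delta> / 2) ((q - c) / real k)"
    using bspec[OF D(2) x(1), rule_format, of "min (\<delta> / 2) ((q - c) / real k)"] \<delta>(1) \<open>k > 0\<close> q by auto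
  then have aM: "a \<in> M" using D by auto
  have "c < tent a q k x"
    using a(2) \<open>k > 0\<close> by (simp add: tent_def less_max_iff_disj field_simps commute)
  moreover have "tent a q k y \<le> f y" if y: "y \<in> M" for y
  proof (cases "d a y < \<delta> / 2")
    case True
    then have "d x y < \<delta>"
      using triangle[OF x(1) aM y] a(2) by simp
    then have "q < f y" using \<delta>(2) x y by (auto simp: subset_iff)
    moreover have "tent a q k y \<le> q"
      using \<open>q > 0\<close> by (simp add: tent_def)
    ultimately show ?thesis by simp
  next
    case False
    have "q \<le> real k * (\<delta> / 2)" using k \<delta>(1) by (simp add: field_simps)
    also have "\<dots> \<le> real k * d a y" using False by (intro mult_left_mono) auto
    finally show ?thesis using f(2)[OF y] by (simp add: tent_def)
  qed
  ultimately show ?thesis using a(1) q(1) by blast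
qed

text \<open>
  Tents with apex in a countable dense set and rational height are countably many, and so are their
  finite maxima, here enumerated through the binary coding of finite sets of naturals.
\<close>
lemma convergence_determining_sequence:
  assumes "countable D" and D: "D \<subseteq> M" "\<forall>x\<in>M. \<forall>e>0. \<exists>a\<in>D. d x a < e"
  shows "\<exists>g :: nat \<Rightarrow> 'a \<Rightarrow> real. (\<forall>i. g i \<in> bounded_continuous mtopology) \<and>
    (\<forall>\<mu> \<nu>. (\<forall>n. \<mu> n \<in> distributions mtopology) \<longrightarrow> \<nu> \<in> distributions mtopology \<longrightarrow>
      (\<forall>i. (\<lambda>n. integral\<^sup>L (\<mu> n) (g i)) \<longlonglongrightarrow> integral\<^sup>L \<nu> (g i)) \<longrightarrow>
      converges_weakly mtopology \<mu> \<nu>)"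
proof -
  \<comment> \<open>The zero function keeps the family nonempty when the space is empty.\<close>
  define C where "C = insert (\<lambda>_. 0) ((\<lambda>(a, q, k). tent a q k) ` (D \<times> \<rat> \<times> UNIV))"
  define \<phi> where "\<phi> = from_nat_into C"
  have "countable C" "C \<noteq> {}"
    using \<open>countable D\<close> countable_rat by (auto simp: C_def)
  then have range: "range \<phi> = C"
    unfolding \<phi>_def by (rule range_from_nat_into[rotated])
  have "(\<lambda>_. 0) \<in> bounded_continuous mtopology"
    by (rule bounded_continuousI[of _ _ 0]) simp_all
  then have C: "h \<in> bounded_continuous mtopology" if "h \<in> C" for h
    using that D tent_bounded_continuous by (auto simp: C_def)
  have \<phi>: "\<phi> j \<in> bounded_continuous mtopology" for j
    using C range by auto
  have sup: "\<exists>j. (\<forall>y\<in>M. \<phi> j y \<le> f y) \<and> c < \<phi> j x"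
    if f: "f \<in> bounded_continuous mtopology" "\<And>y. y \<in> M \<Longrightarrow> 0 \<le> f y" "x \<in> M" "c < f x" for f x c
  proof -
    obtain a q k where *: "a \<in> D" "q \<in> \<rat>" "\<forall>y\<in>M. tent a q k y \<le> f y" "c < tent a q k x"
      using tent_minorant[of D f x c] D f unfolding bounded_continuous_def by blast
    then have "tent a q k \<in> range \<phi>" 
      unfolding range C_def by (intro insertI2 image_eqI[of _ _ "(a, q, k)"]) auto
    then obtain j where "tent a q k = \<phi> j" by blast
    with * show ?thesis by (intro exI[of _ j]) simp
  qed
  show ?thesis
  proof (intro exI[of _ "\<lambda>i. finite_max \<phi> (set_decode i)"] conjI allI impI)
    show "finite_max \<phi> (set_decode i) \<in> bounded_continuous mtopology" for i
      by (rule finite_max_bounded_continuous) (simp_all add: \<phi>)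
    fix \<mu> \<nu>
    assume \<mu>: "\<forall>n. \<mu> n \<in> distributions mtopology" and \<nu>: "\<nu> \<in> distributions mtopology"
      and conv: "\<forall>i. (\<lambda>n. integral\<^sup>L (\<mu> n) (finite_max \<phi> (set_decode i)))
        \<longlonglongrightarrow> integral\<^sup>L \<nu> (finite_max \<phi> (set_decode i))"
    show "converges_weakly mtopology \<mu> \<nu>"
    proof (rule converges_weakly_if_finite_max[of _ _ _ \<phi>])
      fix S :: "nat set" assume "finite S"
      then show "(\<lambda>n. integral\<^sup>L (\<mu> n) (finite_max \<phi> S)) \<longlonglongrightarrow> integral\<^sup>L \<nu> (finite_max \<phi> S)"
        using spec[OF conv, of "set_encode S"] by simp
    qed (use \<mu> \<nu> \<phi> sup in auto)
  qed
qed

text \<open>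
  In a separable metric space every open set is a countable union of closed balls, so their
  preimages decide measurability.
\<close>
lemma measurable_if_mcball:
  assumes "countable D" and D: "D \<subseteq> M" "\<forall>x\<in>M. \<forall>e>0. \<exists>a\<in>D. d x a < e"
    and f: "f \<in> space N \<rightarrow> M"
    and meas: "\<And>a r. a \<in> D \<Longrightarrow> {\<omega> \<in> space N. d a (f \<omega>) \<le> r} \<in> sets N"
  shows "f \<in> N \<rightarrow>\<^sub>M borel_of mtopology"
proof (rule measurable_borel_ofI)
  show "f \<in> space N \<rightarrow> topspace mtopology" using f by simp
next
  fix U assume U: "openin mtopology U"
  define I where "I = {(a, q) \<in> D \<times> \<rat>. mcball a q \<subseteq> U}"
  have "countable I"
    unfolding I_def by (rule countable_subset[of _ "D \<times> \<rat>"])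
      (auto simp: \<open>countable D\<close> countable_rat)
  have "\<exists>(a, q)\<in>I. d a x \<le> q" if "x \<in> U" for x
  proof -
    have x: "x \<in> M" using U that by (auto simp: openin_mtopology)
    obtain r where r: "r > 0" "mball x r \<subseteq> U"
      using U \<open>x \<in> U\<close> unfolding openin_mtopology by blast
    obtain q where q: "q \<in> \<rat>" "0 < q" "q < r / 2"
      using Rats_dense_in_real[of 0 "r / 2"] r(1) by auto
    obtain a where a: "a \<in> D" "d x a < q" using D(2) x q(2) by blast
    have "mcball a q \<subseteq> mball x r"
    proof
      fix y assume "y \<in> mcball a q"
      then show "y \<in> mball x r"
        using triangle[OF x, of a y] a q x by auto
    qed
    then show ?thesis using a q r(2) by (intro bexI[of _ "(a, q)"]) (auto simp: I_def commute)
  qed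
  moreover have "x \<in> U" if "(a, q) \<in> I" "d a x \<le> q" "x \<in> M" for a q x
    using that D by (auto simp: I_def subset_iff)
  ultimately have "f -` U \<inter> space N = (\<Union>(a, q)\<in>I. {\<omega> \<in> space N. d a (f \<omega>) \<le> q})"
    using f by fastforce
  also have "\<dots> \<in> sets N"
    using \<open>countable I\<close> meas by (intro sets.countable_UN') (auto simp: I_def)
  finally show "f -` U \<inter> space N \<in> sets N" .
qed

end

section \<open>The metric space of continuous paths\<close>

definition C_dist :: "real \<Rightarrow> (real \<Rightarrow> real) \<Rightarrow> (real \<Rightarrow> real) \<Rightarrow> real" where
  "C_dist T = mdist (cfunspace (top_of_set {0..T}) euclidean_metric)"

lemma mspace_C: "mspace (cfunspace (top_of_set {0..T}) euclidean_metric) = topspace (C_space T)"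
  by (simp add: C_space_def del: mspace_cfunspace)

interpretation C: Metric_space "topspace (C_space T)" "C_dist T" for T
  unfolding C_dist_def mspace_C[symmetric] by (rule Metric_space_mspace_mdist)

lemma C_mtopology [simp]: "C.mtopology T = C_space T"
  unfolding C_dist_def mspace_C[symmetric] by (simp add: C_space_def mtopology_of_def)

lemma C_dist_le_iff:
  assumes "T \<ge> 0" "f \<in> topspace (C_space T)" "g \<in> topspace (C_space T)"
  shows "C_dist T f g \<le> r \<longleftrightarrow> (\<forall>t\<in>{0..T}. \<bar>f t - g t\<bar> \<le> r)"
  unfolding C_dist_def using assms
  by (subst cfunspace_mdist_le)
    (auto simp: mspace_C dist_real_def topspace_mtopology_of simp del: mspace_cfunspace)

lemma continuous_map_C_eval:
  assumes "t \<in> {0..T}"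
  shows "continuous_map (C_space T) euclideanreal (\<lambda>f. f t)"
proof -
  have T: "T \<ge> 0" using assms by simp
  have *: "\<bar>f t - g t\<bar> \<le> C_dist T f g" if "f \<in> topspace (C_space T)" "g \<in> topspace (C_space T)" for f g
    using C_dist_le_iff[OF T that, of "C_dist T f g"] assms by simp
  have "continuous_map (C.mtopology T) Met_TC.mtopology (\<lambda>f. f t)"
    unfolding Metric_space.continuous_map_to_metric[OF Met_TC.Metric_space_axioms]
  proof (intro ballI allI impI)
    fix f :: "real \<Rightarrow> real" and e :: real
    assume f: "f \<in> topspace (C.mtopology T)" and "e > 0"
    have "g t \<in> Met_TC.mball (f t) e" if "g \<in> C.mball T f e" for g
    proof -
      have "\<bar>f t - g t\<bar> < e"
        using that *[of f g] by (simp add: C.in_mball)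
      then show ?thesis by (simp add: dist_real_def)
    qed
    then show "\<exists>U. openin (C.mtopology T) U \<and> f \<in> U \<and> (\<forall>g\<in>U. g t \<in> Met_TC.mball (f t) e)"
      using f \<open>e > 0\<close>
      by (intro exI[of _ "C.mball T f e"] conjI C.openin_mball) auto
  qed
  then show ?thesis by simp
qed

section \<open>Interpolation and sampling\<close>

definition hat :: "real \<Rightarrow> nat \<Rightarrow> nat \<Rightarrow> real \<Rightarrow> real" where
  "hat T N k t = max 0 (1 - \<bar>real N * t / T - real k\<bar>)"

text \<open>
  Linear interpolation in the hat function basis. Written as a sum it is visibly linear in the
  node values, and it is defined for any \<open>y\<close>, of which it reads only the components \<open>0, \<dots>, N\<close>.
\<close>
definition interp :: "real \<Rightarrow> nat \<Rightarrow> (nat \<Rightarrow> real) \<Rightarrow> real \<Rightarrow> real" where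
  "interp T N y = (\<lambda>t\<in>{0..T}. \<Sum>k\<le>N. y k * hat T N k t)"

definition sample :: "real \<Rightarrow> nat \<Rightarrow> (real \<Rightarrow> real) \<Rightarrow> nat \<Rightarrow> real" where
  "sample T N f = (\<lambda>k. if k < N + 1 then f (real k * T / real N) else 0)"

lemma interp_in_C [simp]: "interp T N y \<in> topspace (C_space T)"
proof -
  have "continuous_on {0..T} (interp T N y) \<longleftrightarrow> continuous_on {0..T} (\<lambda>t. \<Sum>k\<le>N. y k * hat T N k t)"
    by (rule continuous_on_cong) (auto simp: interp_def)
  moreover have "continuous_on {0..T} (\<lambda>t. \<Sum>k\<le>N. y k * hat T N k t)"
    unfolding hat_def divide_inverse by (intro continuous_intros)
  ultimately show ?thesis
    by (auto simp: topspace_C_space) (simp add: interp_def)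
qed

text \<open>
  Hat functions take values in \<open>[0, 1]\<close>. The resulting bound is crude, the maximum in place of the
  sum being optimal, but for fixed \<open>N\<close> it gives continuity of interpolation.
\<close>
lemma interp_diff_le:
  assumes "t \<in> {0..T}"
  shows "\<bar>interp T N y t - interp T N z t\<bar> \<le> (\<Sum>k\<le>N. \<bar>y k - z k\<bar>)"
proof -
  have "\<bar>interp T N y t - interp T N z t\<bar> = \<bar>\<Sum>k\<le>N. (y k - z k) * hat T N k t\<bar>"
    using assms by (simp add: interp_def sum_subtractf left_diff_distrib)
  also have "\<dots> \<le> (\<Sum>k\<le>N. \<bar>(y k - z k) * hat T N k t\<bar>)" by (rule sum_abs)
  also have "\<dots> \<le> (\<Sum>k\<le>N. \<bar>y k - z k\<bar>)"
    by (intro sum_mono) (auto simp: abs_mult hat_def intro!: mult_left_le)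
  finally show ?thesis .
qed

text \<open>Only the two hats at the end points of a grid segment are nonzero on it.\<close>
lemma interp_on_segment:
  assumes "T > 0" "k < N" and t: "t \<in> {real k * T / real N..real (Suc k) * T / real N}"
  shows "interp T N y t = y k * (real k + 1 - real N * t / T) + y (Suc k) * (real N * t / T - real k)"
proof -
  define s where "s = real N * t / T"
  have s: "real k \<le> s" "s \<le> real k + 1"
    using assms by (auto simp: s_def field_simps)
  have "0 \<le> t" using t assms by (auto intro: order.trans[rotated])
  moreover have "t \<le> T"
  proof -
    have "s \<le> real N" using s \<open>k < N\<close> by linarith
    then show ?thesis using assms by (simp add: s_def field_simps)
  qed
  ultimately have "interp T N y t = (\<Sum>j\<le>N. y j * max 0 (1 - \<bar>s - real j\<bar>))"
    by (simp add: interp_def hat_def s_def)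
  also have "\<dots> = (\<Sum>j\<in>{k, Suc k}. y j * max 0 (1 - \<bar>s - real j\<bar>))"
  proof (rule sum.mono_neutral_right)
    show "\<forall>j\<in>{..N} - {k, Suc k}. y j * max 0 (1 - \<bar>s - real j\<bar>) = 0"
    proof
      fix j assume "j \<in> {..N} - {k, Suc k}"
      then have "real j \<le> real k - 1 \<or> real j \<ge> real k + 2" by auto
      then have "1 - \<bar>s - real j\<bar> \<le> 0" using s by auto
      then show "y j * max 0 (1 - \<bar>s - real j\<bar>) = 0" by simp
    qed
  qed (use \<open>k < N\<close> in auto)
  also have "\<dots> = y k * (real k + 1 - s) + y (Suc k) * (s - real k)"
    using s by (cases "s = real k + 1") (simp_all add: max_def abs_if)
  finally show ?thesis by (simp add: s_def)
qed

lemma segment_cover: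
  assumes "T > 0" "N \<ge> 1" "t \<in> {0..T}"
  obtains k where "k < N" "t \<in> {real k * T / real N..real (Suc k) * T / real N}"
  \<comment> \<open>At \<open>t = T\<close> the floor below would be \<open>N\<close>, one past the last segment.\<close>
proof (cases "t = T")
  case True
  then show ?thesis using assms by (intro that[of "N - 1"]) (auto simp: field_simps)
next
  case False
  define k where "k = nat \<lfloor>real N * t / T\<rfloor>"
  have 0: "real N * t / T \<ge> 0" using assms by simp
  have k: "real k \<le> real N * t / T" "real N * t / T < real k + 1"
    using 0 by (auto simp: k_def)
  have "real N * t / T < real N" using assms False by (simp add: field_simps)
  then have "k < N" using k by linarith
  then show ?thesis using k assms by (intro that[of k]) (auto simp: field_simps)
qed

lemma linear_interpolation_interp:
  assumes "T > 0" "N \<ge> 1"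
  shows "linear_interpolation T N y (interp T N y)"
  unfolding linear_interpolation_def
proof (intro conjI allI impI)
  show "continuous_on {0..T} (interp T N y)"
    using interp_in_C[of T N y] by (simp add: topspace_C_space)
next
  fix k assume "k \<le> N"
  show "interp T N y (real k * T / real N) = y k"
  proof (cases "k = N")
    case True
    then show ?thesis
      using interp_on_segment[of T "N - 1" N T y] assms by (simp add: of_nat_diff field_simps)
  next
    case False
    then show ?thesis
      using interp_on_segment[of T k N "real k * T / real N" y] assms \<open>k \<le> N\<close>
      by (simp add: divide_right_mono)
  qed
next
  fix k assume k: "k < N"
  show "\<exists>a b. \<forall>t\<in>{real k * T / real N..real (Suc k) * T / real N}. interp T N y t = a + b * t"
  proof (rule exI[of _ "y k * (real k + 1) - y (Suc k) * real k"],
      rule exI[of _ "(y (Suc k) - y k) * real N / T"], rule ballI)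
    fix t assume "t \<in> {real k * T / real N..real (Suc k) * T / real N}"
    from interp_on_segment[OF assms(1) k this, of y]
    show "interp T N y t = y k * (real k + 1) - y (Suc k) * real k + (y (Suc k) - y k) * real N / T * t"
      by (simp add: algebra_simps diff_divide_distrib)
  qed
qed

text \<open>
  Uniqueness makes the path of an arbitrary interpolating process a continuous function of the
  random vector. Its measurability as a random element of \<open>C([0,T])\<close> follows from this.
\<close>
lemma linear_interpolation_unique:
  assumes "T > 0" "N \<ge> 1" and g: "linear_interpolation T N y g" and t: "t \<in> {0..T}"
  shows "g t = interp T N y t"
proof -
  obtain k where k: "k < N" "t \<in> {real k * T / real N..real (Suc k) * T / real N}"
    using segment_cover[OF assms(1,2) t] .
  obtain a b where ab: "\<And>s. s \<in> {real k * T / real N..real (Suc k) * T / real N} \<Longrightarrow> g s = a + b * s"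
    using g k(1) unfolding linear_interpolation_def by blast
  have nodes: "y k = g (real k * T / real N)" "y (Suc k) = g (real (Suc k) * T / real N)"
    using g k(1) unfolding linear_interpolation_def by (simp_all del: of_nat_Suc)
  define w where "w = T / real N"
  define s where "s = real N * t / T"
  have t_eq: "t = s * w" using assms(1,2) by (simp add: s_def w_def)
  have "y k = a + b * (real k * w)" "y (Suc k) = a + b * ((real k + 1) * w)"
    using ab[of "real k * T / real N"] ab[of "real (Suc k) * T / real N"] nodes assms(1,2)
    by (simp_all add: divide_right_mono w_def add.commute)
  then have "a + b * t = y k * (real k + 1 - s) + y (Suc k) * (s - real k)"
    by (simp add: t_eq algebra_simps)
  then show ?thesis
    unfolding interp_on_segment[OF assms(1) k] ab[OF k(2)] s_def .
qed

text \<open>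
  On each grid segment the interpolated path is a convex combination of the values of \<open>f\<close> at the
  two end points, and by uniform continuity both are close to the values of \<open>f\<close> inside the segment
  once the mesh is fine.
\<close>
lemma interp_sample_uniform:
  assumes "T > 0" "f \<in> topspace (C_space T)" "e > 0"
  shows "\<forall>\<^sub>F N in sequentially. C_dist T (interp T N (sample T N f)) f \<le> e"
proof -
  have "uniformly_continuous_on {0..T} f"
    using assms(2) by (intro compact_uniformly_continuous) (auto simp: topspace_C_space)
  then obtain \<delta> where \<delta>: "\<delta> > 0"
    "\<And>s t. s \<in> {0..T} \<Longrightarrow> t \<in> {0..T} \<Longrightarrow> \<bar>s - t\<bar> < \<delta> \<Longrightarrow> \<bar>f s - f t\<bar> < e"
    using \<open>e > 0\<close> unfolding uniformly_continuous_on_def dist_real_def by metis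
  have "\<forall>\<^sub>F N in sequentially. T / \<delta> < real N"
    using filterlim_real_sequentially by (simp add: filterlim_at_top_dense)
  then show ?thesis
  proof eventually_elim
    case (elim N)
    have "N \<ge> 1" using elim assms(1) \<delta>(1) by (cases N) (auto simp: field_simps)
    have mesh: "T / real N < \<delta>" using elim \<open>N \<ge> 1\<close> \<delta>(1) by (simp add: field_simps)
    have "\<bar>interp T N (sample T N f) t - f t\<bar> \<le> e" if t: "t \<in> {0..T}" for t
    proof -
      obtain k where k: "k < N" "t \<in> {real k * T / real N..real (Suc k) * T / real N}"
        using segment_cover[OF assms(1) \<open>N \<ge> 1\<close> t] .
      define u where "u = real N * t / T - real k"
      have u: "0 \<le> u" "u \<le> 1"
        using k assms(1) by (auto simp: u_def field_simps)
      have node: "j * T / real N \<in> {0..T}" if "j \<in> {0..real N}" for j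
        using that assms(1) \<open>N \<ge> 1\<close> by (auto simp: field_simps)
      have "real (Suc k) * T / real N = real k * T / real N + T / real N"
        by (simp add: distrib_right add_divide_distrib)
      then have near: "\<bar>real k * T / real N - t\<bar> < \<delta>" "\<bar>real (Suc k) * T / real N - t\<bar> < \<delta>"
        using k(2) mesh unfolding atLeastAtMost_iff by (simp_all only: abs_less_iff) linarith+
      have 1: "\<bar>f (real k * T / real N) - f t\<bar> < e"
        using k(1) by (intro \<delta>(2) node t near) auto
      have 2: "\<bar>f (real (Suc k) * T / real N) - f t\<bar> < e"
        using k(1) by (intro \<delta>(2) node t near) auto
      have "interp T N (sample T N f) t - f t =
          (1 - u) * (f (real k * T / real N) - f t) + u * (f (real (Suc k) * T / real N) - f t)"
        unfolding interp_on_segment[OF assms(1) k] using k(1)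
        by (simp add: sample_def u_def algebra_simps)
      also have "\<bar>\<dots>\<bar> \<le> (1 - u) * e + u * e"
        using u 1 2 by (intro order.trans[OF abs_triangle_ineq] add_mono)
          (auto simp: abs_mult intro!: mult_left_mono)
      finally show ?thesis by (simp add: algebra_simps)
    qed
    then show ?case
      using assms by (subst C_dist_le_iff) auto
  qed
qed

lemma continuous_map_sample:
  assumes "T > 0" "N \<ge> 1"
  shows "continuous_map (C_space T) (Euclidean_space (N + 1)) (sample T N)"
proof -
  have "continuous_map (C_space T) (Euclidean_space (N + 1))
      (\<lambda>f k. if k < N + 1 then f (real k * T / real N) else 0)"
    unfolding continuous_map_componentwise_Euclidean_space
    using assms by (intro allI impI continuous_map_C_eval) (auto simp: field_simps)
  then show ?thesis by (simp add: sample_def[abs_def])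
qed

lemma continuous_map_interp:
  assumes "T \<ge> 0"
  shows "continuous_map (Euclidean_space m) (C_space T) (interp T N)"
proof -
  have "continuous_map (Euclidean_space m) (C.mtopology T) (interp T N)"
    unfolding C.continuous_map_to_metric
  proof (intro ballI allI impI)
    fix y :: "nat \<Rightarrow> real" and e :: real
    assume y: "y \<in> topspace (Euclidean_space m)" and "e > 0"
    define D where "D z = (\<Sum>k\<le>N. \<bar>y k - z k\<bar>)" for z :: "nat \<Rightarrow> real"
    define U where "U = {z \<in> topspace (Euclidean_space m). D z \<in> {..<e}}"
    have proj: "continuous_map (Euclidean_space m) euclideanreal (\<lambda>z. z k)" for k
      unfolding Euclidean_space_def by (intro continuous_map_from_subtopology continuous_map_product_projection) simp
    have "continuous_map (Euclidean_space m) euclideanreal D"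
      unfolding D_def by (intro continuous_intros proj) simp_all
    then have "openin (Euclidean_space m) U"
      unfolding U_def by (rule openin_continuous_map_preimage) (simp add: open_lessThan)
    moreover have "y \<in> U" using y \<open>e > 0\<close> by (simp add: U_def D_def)
    moreover have "interp T N z \<in> C.mball T (interp T N y) e" if "z \<in> U" for z
    proof -
      have "C_dist T (interp T N y) (interp T N z) \<le> D z"
        using assms interp_diff_le by (simp add: C_dist_le_iff D_def)
      then show ?thesis using that by (simp add: U_def)
    qed
    ultimately show "\<exists>U. openin (Euclidean_space m) U \<and> y \<in> U \<and>
        (\<forall>z\<in>U. interp T N z \<in> C.mball T (interp T N y) e)"
      by blast
  qed
  then show ?thesis by simp
qed

text \<open>
  Piecewise linear paths with rational node values are dense: interpolate \<open>f\<close> on a fine grid and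
  then perturb the node values. Rational lists index this family, because sequences of
  rationals would be uncountably many.
\<close>
lemma C_separable:
  assumes "T > 0"
  shows "\<exists>D. countable D \<and> D \<subseteq> topspace (C_space T) \<and>
    (\<forall>f\<in>topspace (C_space T). \<forall>e>0. \<exists>g\<in>D. C_dist T f g < e)"
proof (intro exI conjI ballI allI impI)
  let ?D = "range (\<lambda>(N, l :: rat list). interp T N (\<lambda>k. of_rat (l ! k)))"
  show "countable ?D" by simp
  show "?D \<subseteq> topspace (C_space T)" by auto
  fix f e assume f: "f \<in> topspace (C_space T)" and "(e :: real) > 0"
  have "\<forall>\<^sub>F N in sequentially. C_dist T (interp T N (sample T N f)) f \<le> e / 3"
    using \<open>e > 0\<close> by (intro interp_sample_uniform assms f) simp
  then obtain N where N: "C_dist T (interp T N (sample T N f)) f \<le> e / 3"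
    using eventually_happens by force
  define y where "y = sample T N f"
  have "\<exists>q. \<bar>y k - of_rat q\<bar> < e / (3 * real (N + 1))" for k
  proof -
    have "y k < y k + e / (3 * real (N + 1))" using \<open>e > 0\<close> by simp
    from Rats_dense_in_real[OF this] obtain r where r: "r \<in> \<rat>" "y k < r" "r < y k + e / (3 * real (N + 1))"
      by blast
    from r(1) obtain q where "r = of_rat q" by (auto elim: Rats_cases)
    with r show ?thesis by (intro exI[of _ q]) auto
  qed
  then obtain q where q: "\<And>k. \<bar>y k - of_rat (q k)\<bar> < e / (3 * real (N + 1))" by metis
  define z where "z = (\<lambda>k. of_rat (map q [0..<N + 1] ! k) :: real)"
  have "(\<Sum>k\<le>N. \<bar>y k - z k\<bar>) \<le> (\<Sum>k\<le>N. e / (3 * real (N + 1)))"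
  proof (rule sum_mono)
    fix k assume "k \<in> {..N}"
    then have "z k = of_rat (q k)" by (simp add: z_def del: upt_Suc)
    then show "\<bar>y k - z k\<bar> \<le> e / (3 * real (N + 1))" using q[of k] by simp
  qed
  also have "\<dots> = e / 3" by (simp add: field_simps)
  finally have "\<bar>interp T N y t - interp T N z t\<bar> \<le> e / 3" if "t \<in> {0..T}" for t
    using interp_diff_le[OF that] order.trans by blast
  then have "C_dist T (interp T N y) (interp T N z) \<le> e / 3"
    using assms by (subst C_dist_le_iff) auto
  then have "C_dist T f (interp T N z) \<le> e / 3 + e / 3"
    using C.triangle[of f T "interp T N y" "interp T N z"] N f
    by (simp add: y_def C.commute)
  then show "\<exists>g\<in>?D. C_dist T f g < e"
    using \<open>e > 0\<close> by (intro bexI[of _ "interp T N z"]) (auto simp: z_def)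
qed

lemma abs_le_if_on_rationals:
  fixes h :: "real \<Rightarrow> real"
  assumes "T > 0" "continuous_on {0..T} h" "\<And>t. t \<in> {0..T} \<inter> \<rat> \<Longrightarrow> \<bar>h t\<bar> \<le> r" and t: "t \<in> {0..T}"
  shows "\<bar>h t\<bar> \<le> r"
proof (rule ccontr)
  assume "\<not> \<bar>h t\<bar> \<le> r"
  then obtain \<delta> where \<delta>: "\<delta> > 0" "\<And>s. s \<in> {0..T} \<Longrightarrow> \<bar>s - t\<bar> < \<delta> \<Longrightarrow> \<bar>h s - h t\<bar> < \<bar>h t\<bar> - r"
    using assms(2) t unfolding continuous_on_iff dist_real_def
    by (metis diff_gt_0_iff_gt not_le)
  have "max 0 (t - \<delta>) < min T (t + \<delta>)" using t \<delta>(1) assms(1) by auto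
  from Rats_dense_in_real[OF this] obtain s where "s \<in> \<rat>" "max 0 (t - \<delta>) < s" "s < min T (t + \<delta>)"
    by blast
  then have "\<bar>h s - h t\<bar> < \<bar>h t\<bar> - r" "\<bar>h s\<bar> \<le> r"
    by (auto intro!: \<delta>(2) assms(3))
  then show False by arith
qed

text \<open>
  Measurable coordinates suffice: for continuous paths, lying in a closed ball of the supremum norm
  is a condition on countably many times.
\<close>
lemma measurable_into_C:
  assumes "T > 0" and f: "f \<in> space M \<rightarrow> topspace (C_space T)"
    and meas: "\<And>t. t \<in> {0..T} \<Longrightarrow> (\<lambda>\<omega>. f \<omega> t) \<in> borel_measurable M"
  shows "f \<in> M \<rightarrow>\<^sub>M borel_of (C_space T)"
proof -
  obtain D where D: "countable D" "D \<subseteq> topspace (C_space T)"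
    "\<forall>f\<in>topspace (C_space T). \<forall>e>0. \<exists>g\<in>D. C_dist T f g < e"
    using C_separable[OF assms(1)] by blast
  have "f \<in> M \<rightarrow>\<^sub>M borel_of (C.mtopology T)"
  proof (rule C.measurable_if_mcball[OF D f])
    fix g r assume "g \<in> D"
    then have g: "g \<in> topspace (C_space T)" using D by auto
    have "C_dist T g (f \<omega>) \<le> r \<longleftrightarrow> (\<forall>t\<in>{0..T} \<inter> \<rat>. \<bar>g t - f \<omega> t\<bar> \<le> r)" if "\<omega> \<in> space M" for \<omega>
    proof -
      have f\<omega>: "f \<omega> \<in> topspace (C_space T)" using f that by auto
      then have "continuous_on {0..T} (\<lambda>t. g t - f \<omega> t)"
        using g by (auto simp: topspace_C_space intro!: continuous_intros)
      then have "(\<forall>t\<in>{0..T} \<inter> \<rat>. \<bar>g t - f \<omega> t\<bar> \<le> r) \<longrightarrow> (\<forall>t\<in>{0..T}. \<bar>g t - f \<omega> t\<bar> \<le> r)"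
        using abs_le_if_on_rationals[OF \<open>T > 0\<close>] by blast
      moreover have "C_dist T g (f \<omega>) \<le> r \<longleftrightarrow> (\<forall>t\<in>{0..T}. \<bar>g t - f \<omega> t\<bar> \<le> r)"
        using g f\<omega> \<open>T > 0\<close> by (intro C_dist_le_iff) simp_all
      ultimately show ?thesis by blast
    qed
    then have "{\<omega> \<in> space M. C_dist T g (f \<omega>) \<le> r} =
        {\<omega> \<in> space M. \<forall>t\<in>{0..T} \<inter> \<rat>. \<bar>g t - f \<omega> t\<bar> \<le> r}"
      by auto
    also have "\<dots> \<in> sets M"
    proof (rule sets.sets_Collect_countable_All')
      show "countable ({0..T} \<inter> \<rat>)" by (intro countable_Int2 countable_rat)
      fix t assume "t \<in> {0..T} \<inter> \<rat>"
      then have [measurable]: "(\<lambda>\<omega>. f \<omega> t) \<in> borel_measurable M" using meas by auto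
      show "{\<omega> \<in> space M. \<bar>g t - f \<omega> t\<bar> \<le> r} \<in> sets M" by measurable
    qed
    finally show "{\<omega> \<in> space M. C_dist T g (f \<omega>) \<le> r} \<in> sets M" .
  qed
  then show ?thesis by simp
qed

section \<open>Laws of processes and of interpolations\<close>

lemma path_law_in_distributions:
  assumes "T > 0" "continuous_process T M X"
  shows "path_law T M X \<in> distributions (C_space T)"
  unfolding path_law_def
proof (rule distr_in_distributions)
  show "prob_space M" using assms by (simp add: continuous_process_def)
  show "(\<lambda>\<omega>. \<lambda>t\<in>{0..T}. X t \<omega>) \<in> M \<rightarrow>\<^sub>M borel_of (C_space T)"
  proof (rule measurable_into_C[OF assms(1)])
    show "(\<lambda>\<omega>. \<lambda>t\<in>{0..T}. X t \<omega>) \<in> space M \<rightarrow> topspace (C_space T)"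
    proof
      fix \<omega> assume "\<omega> \<in> space M"
      then have "continuous_on {0..T} (\<lambda>t. X t \<omega>)" using assms by (simp add: continuous_process_def)
      then have "continuous_on {0..T} (\<lambda>t\<in>{0..T}. X t \<omega>)"
        by (rule continuous_on_eq) simp
      then show "(\<lambda>t\<in>{0..T}. X t \<omega>) \<in> topspace (C_space T)" by (simp add: topspace_C_space)
    qed
  qed (use assms in \<open>auto simp: continuous_process_def\<close>)
qed

lemma path_law_interpolation:
  assumes "T > 0" "N \<ge> 1" "\<And>\<omega>. \<omega> \<in> space M \<Longrightarrow> linear_interpolation T N (Y \<omega>) (\<lambda>t. Z t \<omega>)"
  shows "path_law T M Z = distr M (borel_of (C_space T)) (\<lambda>\<omega>. interp T N (Y \<omega>))"
  unfolding path_law_def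
proof (rule distr_cong)
  fix \<omega> assume "\<omega> \<in> space M"
  then have "Z t \<omega> = interp T N (Y \<omega>) t" if "t \<in> {0..T}" for t
    using linear_interpolation_unique[OF assms(1,2,3) that] by simp
  then show "(\<lambda>t\<in>{0..T}. Z t \<omega>) = interp T N (Y \<omega>)"
    by (auto simp: fun_eq_iff interp_def)
qed simp_all

lemma interp_measurable:
  assumes "T > 0"
  shows "interp T N \<in> borel_of (Euclidean_space m) \<rightarrow>\<^sub>M borel_of (C_space T)"
  using assms by (intro continuous_map_imp_measurable continuous_map_interp) simp

lemma path_law_interpolates_in_distributions:
  assumes "T > 0" "interpolates_random_vector T \<Phi> M Z"
  shows "path_law T M Z \<in> distributions (C_space T)"
proof -
  obtain N Y where N: "N \<ge> 1" and Y: "random_vector_in \<Phi> (N + 1) M Y"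
    and Z: "\<And>\<omega>. \<omega> \<in> space M \<Longrightarrow> linear_interpolation T N (Y \<omega>) (\<lambda>t. Z t \<omega>)"
    using assms(2) unfolding interpolates_random_vector_def by blast
  have "(\<lambda>\<omega>. interp T N (Y \<omega>)) \<in> M \<rightarrow>\<^sub>M borel_of (C_space T)"
    using Y by (intro measurable_compose[OF _ interp_measurable[OF assms(1)]])
      (auto simp: random_vector_in_def)
  then have "distr M (borel_of (C_space T)) (\<lambda>\<omega>. interp T N (Y \<omega>)) \<in> distributions (C_space T)"
    using Y by (intro distr_in_distributions) (auto simp: random_vector_in_def)
  then show ?thesis
    using path_law_interpolation[of T N M Y Z] assms(1) N Z by simp
qed

text \<open>
  Every distribution in \<open>\<Phi>\<close> is the law of the identity on the probability space that it defines;
  so choosing distributions in \<open>\<Phi>\<close> is the same as choosing random vectors.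
\<close>
lemma interpolates_identity:
  assumes "T > 0" "N \<ge> 1" and \<mu>: "\<mu> \<in> \<Phi> \<inter> distributions (Euclidean_space (N + 1))"
  shows "interpolates_random_vector T \<Phi> \<mu> (\<lambda>t y. interp T N y t)"
    and "path_law T \<mu> (\<lambda>t y. interp T N y t) = distr \<mu> (borel_of (C_space T)) (interp T N)"
proof -
  have sets: "sets \<mu> = sets (borel_of (Euclidean_space (N + 1)))" and "prob_space \<mu>"
    using \<mu> by (auto simp: distributionsD)
  have "distr \<mu> (borel_of (Euclidean_space (N + 1))) (\<lambda>y. y) = \<mu>"
    by (rule distr_id2) (simp add: sets)
  moreover have "(\<lambda>y. y) \<in> \<mu> \<rightarrow>\<^sub>M borel_of (Euclidean_space (N + 1))"
    by (rule measurable_ident_sets[OF sets])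
  ultimately have "random_vector_in \<Phi> (N + 1) \<mu> (\<lambda>y. y)"
    using \<mu> \<open>prob_space \<mu>\<close> by (simp add: random_vector_in_def)
  moreover have lin: "linear_interpolation T N y (\<lambda>t. interp T N y t)" for y
    using linear_interpolation_interp[OF assms(1,2)] by simp
  ultimately show "interpolates_random_vector T \<Phi> \<mu> (\<lambda>t y. interp T N y t)"
    unfolding interpolates_random_vector_def using assms(2) by blast
  show "path_law T \<mu> (\<lambda>t y. interp T N y t) = distr \<mu> (borel_of (C_space T)) (interp T N)"
    by (rule path_law_interpolation[OF assms(1,2) lin])
qed

section \<open>Approximation by interpolations\<close>

lemma integral_distr_bounded_continuous:
  assumes "\<mu> \<in> distributions X" "continuous_map X Y h" "g \<in> bounded_continuous Y"
  shows "integral\<^sup>L (distr \<mu> (borel_of Y) h) g = integral\<^sup>L \<mu> (\<lambda>x. g (h x))"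
proof (rule integral_distr)
  show "h \<in> \<mu> \<rightarrow>\<^sub>M borel_of Y"
    using continuous_map_imp_measurable[OF assms(2)] 
      measurable_cong_sets[OF distributionsD(2)[OF assms(1)] refl] by blast
  show "g \<in> borel_measurable (borel_of Y)"
    using assms(3) continuous_map_imp_measurable[of Y euclideanreal g]
    by (simp add: bounded_continuous_def borel_of_euclidean)
qed

text \<open>
  Pathwise uniform convergence of the interpolated samples, integrated by dominated convergence.
\<close>
lemma integral_interp_sample_tendsto:
  assumes "T > 0" and \<nu>: "\<nu> \<in> distributions (C_space T)" and g: "g \<in> bounded_continuous (C_space T)"
  shows "(\<lambda>n. integral\<^sup>L \<nu> (\<lambda>f. g (interp T (Suc n) (sample T (Suc n) f)))) \<longlonglongrightarrow> integral\<^sup>L \<nu> g"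
proof -
  interpret prob_space \<nu> using \<nu> by (rule distributionsD)
  obtain B where B: "\<And>f. f \<in> topspace (C_space T) \<Longrightarrow> \<bar>g f\<bar> \<le> B"
    using bounded_continuousE[OF g] by metis
  show ?thesis
  proof (rule integral_dominated_convergence[where w = "\<lambda>_. B"])
    show "g \<in> borel_measurable \<nu>" by (rule bounded_continuous_measurable[OF \<nu> g])
    show "integrable \<nu> (\<lambda>_. B)" by simp
    show "(\<lambda>f. g (interp T (Suc n) (sample T (Suc n) f))) \<in> borel_measurable \<nu>" for n
    proof (intro bounded_continuous_measurable[OF \<nu>] bounded_continuous_compose[OF _ g])
      show "continuous_map (C_space T) (C_space T) (\<lambda>f. interp T (Suc n) (sample T (Suc n) f))"
        using continuous_map_compose[OF continuous_map_sample continuous_map_interp] assms(1)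
        by (simp add: o_def)
    qed
    show "AE f in \<nu>. norm (g (interp T (Suc n) (sample T (Suc n) f))) \<le> B" for n
      using B by simp
    have "(\<lambda>n. g (interp T (Suc n) (sample T (Suc n) f))) \<longlonglongrightarrow> g f" if f: "f \<in> topspace (C_space T)" for f
    proof -
      have "limitin (C.mtopology T) (\<lambda>N. interp T N (sample T N f)) f sequentially"
        unfolding C.limitin_metric
      proof (intro conjI f allI impI)
        fix e :: real assume "e > 0"
        then show "\<forall>\<^sub>F N in sequentially. interp T N (sample T N f) \<in> topspace (C_space T) \<and>
            C_dist T (interp T N (sample T N f)) f < e"
          using interp_sample_uniform[OF assms(1) f, of "e / 2"] by (auto elim!: eventually_mono)
      qed
      then have "limitin euclideanreal (g \<circ> (\<lambda>N. interp T N (sample T N f))) (g f) sequentially"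
        using g by (intro continuous_map_limit) (auto simp: bounded_continuous_def)
      then have "(\<lambda>N. g (interp T N (sample T N f))) \<longlonglongrightarrow> g f" by (simp add: o_def)
      then show ?thesis by (rule LIMSEQ_Suc)
    qed
    then show "AE f in \<nu>. (\<lambda>n. g (interp T (Suc n) (sample T (Suc n) f))) \<longlonglongrightarrow> g f"
      by (intro AE_I2) (simp add: distributionsD(3)[OF \<nu>])
  qed
qed

text \<open>
  The diagonal argument. At stage \<open>n\<close> the grid has \<open>Suc n\<close> segments and \<open>\<rho> n\<close> is the law of the sampled path;
  density of \<open>\<Phi>\<close> supplies \<open>\<mu> n\<close> that matches \<open>\<rho> n\<close> up to \<open>1 / (n + 1)\<close> on the first \<open>n + 1\<close>
  test functions, pulled back along interpolation. Each test function is considered from some stage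
  on, so its integrals converge, and the family of test functions determines weak convergence.
\<close>
lemma interpolation_approx:
  assumes "T > 0"
    and dense: "\<And>m. m \<ge> 1 \<Longrightarrow>
      weakly_dense (Euclidean_space m) (\<Phi> \<inter> distributions (Euclidean_space m))"
    and \<nu>: "\<nu> \<in> distributions (C_space T)"
  obtains \<mu> :: "nat \<Rightarrow> (nat \<Rightarrow> real) measure"
    where "\<And>n. \<mu> n \<in> \<Phi> \<inter> distributions (Euclidean_space (Suc n + 1))"
      and "converges_weakly (C_space T) (\<lambda>n. distr (\<mu> n) (borel_of (C_space T)) (interp T (Suc n))) \<nu>"
proof -
  obtain D where D: "countable D" "D \<subseteq> topspace (C_space T)"
    "\<forall>f\<in>topspace (C_space T). \<forall>e>0. \<exists>g\<in>D. C_dist T f g < e"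
    using C_separable[OF assms(1)] by blast
  obtain g :: "nat \<Rightarrow> (real \<Rightarrow> real) \<Rightarrow> real" where
    g_all: "\<forall>i. g i \<in> bounded_continuous (C_space T)" and
    determining: "\<forall>\<mu> \<nu>. (\<forall>n. \<mu> n \<in> distributions (C_space T)) \<longrightarrow>
      \<nu> \<in> distributions (C_space T) \<longrightarrow>
      (\<forall>i. (\<lambda>n. integral\<^sup>L (\<mu> n) (g i)) \<longlonglongrightarrow> integral\<^sup>L \<nu> (g i)) \<longrightarrow>
      converges_weakly (C_space T) \<mu> \<nu>"
    using C.convergence_determining_sequence[OF D, unfolded C_mtopology]
    by (elim exE conjE) (rule that)
  have g: "g i \<in> bounded_continuous (C_space T)" for i
    using g_all by blast
  let ?E = "\<lambda>n. Euclidean_space (Suc n + 1)" and ?I = "\<lambda>n. interp T (Suc n)"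
    and ?S = "\<lambda>n. sample T (Suc n)"
  have I: "continuous_map (?E n) (C_space T) (?I n)" for n
    using assms(1) by (intro continuous_map_interp) simp
  have S: "continuous_map (C_space T) (?E n) (?S n)" for n
    using assms(1) by (intro continuous_map_sample) simp_all
  define \<rho> where "\<rho> n = distr \<nu> (borel_of (?E n)) (?S n)" for n
  have \<rho>: "\<rho> n \<in> distributions (?E n)" for n
    unfolding \<rho>_def
    using continuous_map_imp_measurable[OF S, of n] measurable_cong_sets[OF distributionsD(2)[OF \<nu>] refl]
    by (intro distr_in_distributions distributionsD[OF \<nu>]) blast
  have "\<exists>\<mu>\<in>\<Phi> \<inter> distributions (?E n). \<forall>i\<le>n.
      \<bar>integral\<^sup>L \<mu> (\<lambda>y. g i (?I n y)) - integral\<^sup>L (\<rho> n) (\<lambda>y. g i (?I n y))\<bar> < inverse (real (Suc n))" for n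
  proof -
    have "\<rho> n \<in> weak_topology (?E n) closure_of (\<Phi> \<inter> distributions (?E n))"
      using dense[of "Suc n + 1"] \<rho> by (simp add: weakly_dense_def)
    then obtain \<mu> where \<mu>: "\<mu> \<in> \<Phi> \<inter> distributions (?E n)" and close:
      "\<And>h. h \<in> (\<lambda>i y. g i (?I n y)) ` {..n} \<Longrightarrow> 
        \<bar>integral\<^sup>L \<mu> h - integral\<^sup>L (\<rho> n) h\<bar> < inverse (real (Suc n))"
    proof (rule weak_closure_approx)
      show "(\<lambda>i y. g i (?I n y)) ` {..n} \<subseteq> bounded_continuous (?E n)"
        using bounded_continuous_compose[OF I g] by blast
    qed auto
    show ?thesis
      by (intro bexI[OF _ \<mu>] allI impI close) auto
  qed
  then obtain \<mu> where \<mu>: "\<And>n. \<mu> n \<in> \<Phi> \<inter> distributions (?E n)" and close: "\<And>n i. i \<le> n \<Longrightarrow>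
      \<bar>integral\<^sup>L (\<mu> n) (\<lambda>y. g i (?I n y)) - integral\<^sup>L (\<rho> n) (\<lambda>y. g i (?I n y))\<bar> < inverse (real (Suc n))"
    by metis
  have \<mu>': "\<mu> n \<in> distributions (?E n)" for n using \<mu> by blast
  have "converges_weakly (C_space T) (\<lambda>n. distr (\<mu> n) (borel_of (C_space T)) (?I n)) \<nu>"
  proof (rule determining[rule_format])
    show "distr (\<mu> n) (borel_of (C_space T)) (?I n) \<in> distributions (C_space T)" for n
      using interp_measurable[OF assms(1)] measurable_cong_sets[OF distributionsD(2)[OF \<mu>'] refl]
      by (intro distr_in_distributions distributionsD[OF \<mu>']) blast
    show "\<nu> \<in> distributions (C_space T)" by (rule \<nu>)
    fix i
    have 1: "(\<lambda>n. integral\<^sup>L (\<mu> n) (\<lambda>y. g i (?I n y)) - integral\<^sup>L (\<rho> n) (\<lambda>y. g i (?I n y))) \<longlonglongrightarrow> 0"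
    proof (rule Lim_null_comparison)
      show "\<forall>\<^sub>F n in sequentially. norm (integral\<^sup>L (\<mu> n) (\<lambda>y. g i (?I n y)) - 
          integral\<^sup>L (\<rho> n) (\<lambda>y. g i (?I n y))) \<le> inverse (real (Suc n))"
        using eventually_ge_at_top[of i] by (rule eventually_mono) (simp only: real_norm_def less_imp_le[OF close])
    qed (rule LIMSEQ_inverse_real_of_nat)
    have 2: "(\<lambda>n. integral\<^sup>L (\<rho> n) (\<lambda>y. g i (?I n y))) \<longlonglongrightarrow> integral\<^sup>L \<nu> (g i)"
      unfolding \<rho>_def integral_distr_bounded_continuous[OF \<nu> S bounded_continuous_compose[OF I g]]
      by (rule integral_interp_sample_tendsto[OF assms(1) \<nu> g])
    have "(\<lambda>n. integral\<^sup>L (\<mu> n) (\<lambda>y. g i (?I n y))) \<longlonglongrightarrow> integral\<^sup>L \<nu> (g i)"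
      using tendsto_add[OF 1 2] by simp
    then show "(\<lambda>n. integral\<^sup>L (distr (\<mu> n) (borel_of (C_space T)) (?I n)) (g i)) \<longlonglongrightarrow> integral\<^sup>L \<nu> (g i)"
      by (simp add: integral_distr_bounded_continuous[OF \<mu>' I g])
  qed
  with \<mu> show ?thesis by (rule that)
qed

theorem theorem3p3:
  fixes \<Phi> :: "(nat \<Rightarrow> real) measure set" and T :: real
  assumes "\<Phi> \<subseteq> (\<Union>d\<in>{1..}. distributions (Euclidean_space d))"
    and "\<And>d. d \<ge> 1 \<Longrightarrow>
           weakly_dense (Euclidean_space d) (\<Phi> \<inter> distributions (Euclidean_space d))"
    and "T > 0"
  shows "weakly_dense (C_space T) (interpolation_laws T \<Phi>) \<and>
    (\<forall>(M :: 'a measure) X. continuous_process T M X \<longrightarrow>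
       (\<exists>(\<Omega> :: nat \<Rightarrow> (nat \<Rightarrow> real) measure) Z.
          (\<forall>n. interpolates_random_vector T \<Phi> (\<Omega> n) (Z n)) \<and>
          converges_weakly (C_space T) (\<lambda>n. path_law T (\<Omega> n) (Z n)) (path_law T M X)))"
proof (rule conjI)
  have approx: "\<exists>(\<Omega> :: nat \<Rightarrow> (nat \<Rightarrow> real) measure) Z.
      (\<forall>n. interpolates_random_vector T \<Phi> (\<Omega> n) (Z n)) \<and>
      converges_weakly (C_space T) (\<lambda>n. path_law T (\<Omega> n) (Z n)) \<nu>"
    if \<nu>: "\<nu> \<in> distributions (C_space T)" for \<nu>
  proof (rule interpolation_approx[OF assms(3,2) \<nu>])
    fix \<mu> :: "nat \<Rightarrow> (nat \<Rightarrow> real) measure"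
    assume \<mu>: "\<And>n. \<mu> n \<in> \<Phi> \<inter> distributions (Euclidean_space (Suc n + 1))"
      and conv: "converges_weakly (C_space T)
        (\<lambda>n. distr (\<mu> n) (borel_of (C_space T)) (interp T (Suc n))) \<nu>"
    have "interpolates_random_vector T \<Phi> (\<mu> n) (\<lambda>t y. interp T (Suc n) y t)"
      and "path_law T (\<mu> n) (\<lambda>t y. interp T (Suc n) y t) =
        distr (\<mu> n) (borel_of (C_space T)) (interp T (Suc n))" for n
      by (rule interpolates_identity[OF assms(3) _ \<mu>], simp)+
    with conv show ?thesis
      by (intro exI[of _ \<mu>] exI[of _ "\<lambda>n t y. interp T (Suc n) y t"]) simp
  qed
  show "\<forall>(M :: 'a measure) X. continuous_process T M X \<longrightarrow>
       (\<exists>(\<Omega> :: nat \<Rightarrow> (nat \<Rightarrow> real) measure) Z.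
          (\<forall>n. interpolates_random_vector T \<Phi> (\<Omega> n) (Z n)) \<and>
          converges_weakly (C_space T) (\<lambda>n. path_law T (\<Omega> n) (Z n)) (path_law T M X))"
    by (intro allI impI approx path_law_in_distributions assms(3))
  show "weakly_dense (C_space T) (interpolation_laws T \<Phi>)"
    unfolding weakly_dense_def
  proof (intro conjI equalityI subsetI)
    fix \<kappa> assume "\<kappa> \<in> interpolation_laws T \<Phi>"
    then show "\<kappa> \<in> distributions (C_space T)"
      using path_law_interpolates_in_distributions[OF assms(3)] by (auto simp: interpolation_laws_def)
  next
    fix \<nu> assume "\<nu> \<in> weak_topology (C_space T) closure_of interpolation_laws T \<Phi>"
    then show "\<nu> \<in> distributions (C_space T)" by (simp add: in_closure_of)
  next
    fix \<nu> assume \<nu>: "\<nu> \<in> distributions (C_space T)"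
    from approx[OF \<nu>] obtain \<Omega> :: "nat \<Rightarrow> (nat \<Rightarrow> real) measure" and Z where
      Z: "\<And>n. interpolates_random_vector T \<Phi> (\<Omega> n) (Z n)"
      and conv: "converges_weakly (C_space T) (\<lambda>n. path_law T (\<Omega> n) (Z n)) \<nu>"
      by (elim exE conjE) (rule that, rule spec)
    then have lim: "limitin (weak_topology (C_space T)) (\<lambda>n. path_law T (\<Omega> n) (Z n)) \<nu> sequentially"
      using path_law_interpolates_in_distributions[OF assms(3)]
      by (subst (asm) converges_weakly_iff_limitin) auto
    have laws: "path_law T (\<Omega> n) (Z n) \<in> interpolation_laws T \<Phi>" for n
      using Z by (auto simp: interpolation_laws_def)
    have "\<exists>\<kappa>\<in>interpolation_laws T \<Phi>. \<kappa> \<in> U"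
      if U: "\<nu> \<in> U" "openin (weak_topology (C_space T)) U" for U
    proof -
      have "\<forall>\<^sub>F n in sequentially. path_law T (\<Omega> n) (Z n) \<in> U"
        using lim U by (simp add: limitin_def)
      then obtain n where "path_law T (\<Omega> n) (Z n) \<in> U"
        by (auto simp: eventually_sequentially)
      with laws[of n] show ?thesis ..
    qed
    then show "\<nu> \<in> weak_topology (C_space T) closure_of interpolation_laws T \<Phi>"
      using \<nu> by (auto simp: in_closure_of)
  qed
qed

end
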